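(* Let $X$ be a complex Banach space and let $-A\colon \mathsf D(A)\subseteq X\to X$ be the infinitesimal generator of a strongly measurable semigroup $(S(t))_{t\ge 0}$ on $X$ such that $\|S(t)\|_{\mathscr L(X)}\le M_0e^{-wt}$ for all $t\ge0$, for some $M_0\in[1,\infty)$ and $w\in[0,\infty)$. Let $t_0\in\mathbb R$ and let $g\colon(-\infty,t_0]\to X$ be bounded and continuous. Then for all $t\in(t_0,\infty)$, as $\varepsilon\to0$ with $\varepsilon\in(0,1)$, $$\frac{\sin(\pi\varepsilon)}{\pi}\int_0^\infty\frac{\tau^{\varepsilon-1}}{\tau+1}S((t-t_0)(\tau+1))\,g(t_0-(t-t_0)\tau)\,\mathrm d\tau\;\longrightarrow\;S(t-t_0)g(t_0)\quad\text{in }X.$$ If, in addition, the semigroup is uniformly exponentially stable, i.e. there exist $M_0\in[1,\infty)$ and $w\in(0,\infty)$ such that $\|S(t)\|_{\mathscr L(X)}\le M_0e^{-wt}$ for all $t\ge0$, then for all $t\in(t_0,\infty)$, as $\varepsilon\to0$ with $\varepsilon\in(0,1)$, $$\frac{\sin(\pi\varepsilon)}{\pi}\int_0^\infty\frac{\tau^{-\varepsilon}}{\tau+1}S((t-t_0)(\tau+1))\,g(t_0-(t-t_0)\tau)\,\mathrm d\tau\;\longrightarrow\;0\quad\text{in }X.$$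
   Context: $(S(t))_{t\ge0}\subseteq\mathscr L(X)$ (bounded linear operators on $X$) is a strongly measurable semigroup if $S(0)=\mathrm{Id}_X$, $S(t+r)=S(t)S(r)$ for all $t,r\ge0$, and $t\mapsto S(t)x$ is strongly measurable on $[0,\infty)$ for every $x\in X$. If $\|S(t)\|\le M_0e^{-wt}$, a linear operator $G\colon\mathsf D(G)\subseteq X\to X$ is its infinitesimal generator if for all $\lambda\in\mathbb C$ with $\operatorname{Re}\lambda>w$ the operator $\lambda\,\mathrm{Id}_X-G$ has a bounded inverse and $\langle(\lambda\,\mathrm{Id}_X-G)^{-1}x,x^*\rangle=\int_0^\infty e^{-\lambda t}\langle S(t)x,x^*\rangle\,\mathrm dt$ for all $x\in X$, $x^*\in X^*$. No strong continuity at $0$ is assumed. For such a semigroup, $t\mapsto S(t)x$ is continuous on $(0,\infty)$ for every $x\in X$. Integrals are Bochner integrals. *)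

theory Defs
  imports "HOL-Analysis.Analysis"
begin

section \<open>Complex Banach spaces\<close>

text \<open>
  The complex scalar multiplication extends the real one of the underlying real Banach space.
\<close>

class complex_banach = banach +
  fixes scaleC :: "complex \<Rightarrow> 'a \<Rightarrow> 'a" (infixr \<open>*\<^sub>C\<close> 75)
  assumes scaleC_of_real: "complex_of_real r *\<^sub>C x = r *\<^sub>R x"
    and scaleC_add_right: "c *\<^sub>C (x + y) = c *\<^sub>C x + c *\<^sub>C y"
    and scaleC_add_left: "(c + d) *\<^sub>C x = c *\<^sub>C x + d *\<^sub>C x"
    and scaleC_scaleC: "c *\<^sub>C d *\<^sub>C x = (c * d) *\<^sub>C x"
    and norm_scaleC: "norm (c *\<^sub>C x) = cmod c * norm x"

instantiation complex :: complex_banach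
begin

definition scaleC_complex :: "complex \<Rightarrow> complex \<Rightarrow> complex" where
  "scaleC_complex c z = c * z"

instance
  by standard
    (simp_all add: scaleC_complex_def ring_distribs mult.assoc norm_mult scaleR_conv_of_real)

end

definition complex_subspace :: "'a::complex_banach set \<Rightarrow> bool" where
  "complex_subspace D \<longleftrightarrow>
    0 \<in> D \<and> (\<forall>x\<in>D. \<forall>y\<in>D. x + y \<in> D) \<and> (\<forall>c. \<forall>x\<in>D. c *\<^sub>C x \<in> D)"

definition clinear_on :: "'a::complex_banach set \<Rightarrow> ('a \<Rightarrow> 'b::complex_banach) \<Rightarrow> bool" where
  "clinear_on D f \<longleftrightarrow>
    (\<forall>x\<in>D. \<forall>y\<in>D. f (x + y) = f x + f y) \<and> (\<forall>c. \<forall>x\<in>D. f (c *\<^sub>C x) = c *\<^sub>C f x)"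

text \<open>The operator norm of such a map is \<^const>\<open>onorm\<close>.\<close>

definition bounded_clinear :: "('a::complex_banach \<Rightarrow> 'b::complex_banach) \<Rightarrow> bool" where
  "bounded_clinear f \<longleftrightarrow> bounded_linear f \<and> clinear_on UNIV f"


section \<open>Strong measurability and the Bochner integral\<close>

text \<open>
  The library's \<^const>\<open>has_bochner_integral\<close> is restricted to second-countable spaces, where Borel
  measurability is strong measurability.  Below, its definition is repeated for arbitrary Banach
  spaces with strong measurability in place of Borel measurability.
\<close>

definition strongly_measurable :: "'a measure \<Rightarrow> ('a \<Rightarrow> 'b::real_normed_vector) \<Rightarrow> bool" where
  "strongly_measurable M f \<longleftrightarrow>
    (\<exists>s. (\<forall>i. simple_function M (s i)) \<and> (AE x in M. (\<lambda>i. s i x) \<longlonglongrightarrow> f x))"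

definition has_strong_bochner_integral ::
    "'a measure \<Rightarrow> ('a \<Rightarrow> 'b::real_normed_vector) \<Rightarrow> 'b \<Rightarrow> bool" where
  "has_strong_bochner_integral M f v \<longleftrightarrow>
    strongly_measurable M f \<and>
    (\<exists>s. (\<forall>i. Bochner_Integration.simple_bochner_integrable M (s i)) \<and>
         (\<lambda>i. \<integral>\<^sup>+x. norm (f x - s i x) \<partial>M) \<longlonglongrightarrow> 0 \<and>
         (\<lambda>i. Bochner_Integration.simple_bochner_integral M (s i)) \<longlonglongrightarrow> v)"

definition strong_bochner_integrable ::
    "'a measure \<Rightarrow> ('a \<Rightarrow> 'b::real_normed_vector) \<Rightarrow> bool" where
  "strong_bochner_integrable M f \<longleftrightarrow> (\<exists>v. has_strong_bochner_integral M f v)"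

definition strong_bochner_integral ::
    "'a measure \<Rightarrow> ('a \<Rightarrow> 'b::real_normed_vector) \<Rightarrow> 'b" where
  "strong_bochner_integral M f =
    (if strong_bochner_integrable M f then THE v. has_strong_bochner_integral M f v else 0)"


section \<open>Semigroups and generators\<close>

text \<open>
  Semigroups are indexed by \<^typ>\<open>real\<close>; values at negative times are unconstrained.
\<close>

definition strongly_measurable_semigroup :: "(real \<Rightarrow> 'a::complex_banach \<Rightarrow> 'a) \<Rightarrow> bool" where
  "strongly_measurable_semigroup S \<longleftrightarrow>
    (\<forall>t\<ge>0. bounded_clinear (S t)) \<and>
    S 0 = id \<and>
    (\<forall>t\<ge>0. \<forall>r\<ge>0. S (t + r) = S t \<circ> S r) \<and>
    (\<forall>x. strongly_measurable (lebesgue_on {0..}) (\<lambda>t. S t x))"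

definition exp_bounded :: "(real \<Rightarrow> 'a::complex_banach \<Rightarrow> 'a) \<Rightarrow> real \<Rightarrow> real \<Rightarrow> bool" where
  "exp_bounded S M\<^sub>0 w \<longleftrightarrow> (\<forall>t\<ge>0. onorm (S t) \<le> M\<^sub>0 * exp (- w * t))"

definition uniformly_exponentially_stable :: "(real \<Rightarrow> 'a::complex_banach \<Rightarrow> 'a) \<Rightarrow> bool" where
  "uniformly_exponentially_stable S \<longleftrightarrow> (\<exists>M\<^sub>0\<ge>1. \<exists>w>0. exp_bounded S M\<^sub>0 w)"

definition bounded_inverse ::
    "'a::complex_banach set \<Rightarrow> ('a \<Rightarrow> 'a) \<Rightarrow> ('a \<Rightarrow> 'a) \<Rightarrow> bool" where
  "bounded_inverse D T R \<longleftrightarrow>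
    bounded_clinear R \<and> (\<forall>x. R x \<in> D \<and> T (R x) = x) \<and> (\<forall>x\<in>D. R (T x) = x)"

text \<open>
  An unbounded operator is a total function together with its domain \<open>D\<close>; values outside \<open>D\<close> are
  irrelevant.  Here \<open>w\<close> is the exponent of a bound \<open>exp_bounded S M\<^sub>0 w\<close>.  The dual pairing
  \<open>\<langle>y, \<phi>\<rangle>\<close> is \<open>\<phi> y\<close>, with \<open>\<phi>\<close> a bounded complex-linear functional.
\<close>

definition infinitesimal_generator ::
    "real \<Rightarrow> (real \<Rightarrow> 'a::complex_banach \<Rightarrow> 'a) \<Rightarrow> 'a set \<Rightarrow> ('a \<Rightarrow> 'a) \<Rightarrow> bool" where
  "infinitesimal_generator w S D G \<longleftrightarrow>
    complex_subspace D \<and> clinear_on D G \<and>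
    (\<forall>z. Re z > w \<longrightarrow>
      (\<exists>R. bounded_inverse D (\<lambda>x. z *\<^sub>C x - G x) R \<and>
        (\<forall>x. \<forall>\<phi> :: 'a \<Rightarrow> complex. bounded_clinear \<phi> \<longrightarrow>
          \<phi> (R x) = (LINT t|lebesgue_on {0..}. exp (- z * complex_of_real t) * \<phi> (S t x)))))"

end

theory Submission
  imports Defs
begin

text \<open>
  Write \<open>c = t - t\<^sub>0 > 0\<close> and \<open>h \<tau> = S (c * (\<tau> + 1)) (g (t\<^sub>0 - c * \<tau>))\<close>. A strongly measurable,
  bounded semigroup is strongly continuous on \<open>(0, \<infinity>)\<close>; as the times \<open>c * (\<tau> + 1)\<close> are at least \<open>c\<close>, the
  function \<open>h\<close> is bounded and continuous on \<open>[0, \<infinity>)\<close> with \<open>h 0 = S c (g t\<^sub>0)\<close>. The statement thus becomes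
  one about scalar kernels integrated against a continuous bounded vector-valued function.

  For the first limit, the kernel \<open>\<tau> powr (\<epsilon> - 1) / (\<tau> + 1)\<close> has mass \<open>1 / \<epsilon> + O(1)\<close>, and outside every
  neighbourhood of \<open>0\<close> its mass stays bounded. Multiplied by \<open>sin (pi * \<epsilon>) / pi\<close>, which is asymptotic to \<open>\<epsilon>\<close>,
  it is an approximate identity at \<open>0\<close> and picks out \<open>h 0\<close>; this is
  \<open>singular_kernel_concentrates_at_0\<close>. For the second limit, exponential stability makes \<open>h\<close> decay
  exponentially, so the integrals stay bounded while the prefactor tends to \<open>0\<close>
  (\<open>decaying_kernel_vanishes\<close>).

  The continuity on \<open>(0, \<infinity>)\<close> is \<open>semigroup_orbit_continuous\<close>. It follows from Steinhaus' theorem on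
  difference sets, applied to a set of times of positive measure on which an orbit is nearly
  constant. The integrals are controlled through
  \<open>strong_bochner_integral_close_to_scaleR\<close>, which reduces both integrability and norm estimates
  to integrals of real functions.
\<close>

section \<open>Strongly measurable functions\<close>

lemma strongly_measurable_simple: "simple_function M s \<Longrightarrow> strongly_measurable M s"
  unfolding strongly_measurable_def by (rule exI[of _ "\<lambda>_. s"]) simp

lemma strongly_measurable_diff:
  assumes "strongly_measurable M f" "strongly_measurable M g"
  shows "strongly_measurable M (\<lambda>x. f x - g x)"
proof -
  obtain s t where s: "\<And>i. simple_function M (s i)" "AE x in M. (\<lambda>i. s i x) \<longlonglongrightarrow> f x"
    and t: "\<And>i. simple_function M (t i)" "AE x in M. (\<lambda>i. t i x) \<longlonglongrightarrow> g x"
    using assms unfolding strongly_measurable_def by blast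
  show ?thesis
    unfolding strongly_measurable_def
  proof (intro exI[of _ "\<lambda>i x. s i x - t i x"] conjI allI)
    show "simple_function M (\<lambda>x. s i x - t i x)" for i
      by (rule simple_function_compose2[OF s(1) t(1)])
    show "AE x in M. (\<lambda>i. s i x - t i x) \<longlonglongrightarrow> f x - g x"
      using s(2) t(2) by eventually_elim (rule tendsto_diff)
  qed
qed

lemma strongly_measurable_scaleR_left:
  fixes k :: "'a \<Rightarrow> real"
  assumes "k \<in> borel_measurable M"
  shows "strongly_measurable M (\<lambda>x. k x *\<^sub>R y)"
proof -
  obtain s where s: "\<And>i. simple_function M (s i)" "\<And>x. x \<in> space M \<Longrightarrow> (\<lambda>i. s i x) \<longlonglongrightarrow> k x"
    using borel_measurable_implies_sequence_metric[OF assms] by blast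
  show ?thesis
    unfolding strongly_measurable_def
    by (intro exI[of _ "\<lambda>i x. s i x *\<^sub>R y"] conjI allI simple_function_compose1[OF s(1)]
        AE_I2 tendsto_intros s(2))
qed

text \<open>
  The identity on \<open>U\<close> is a limit of simple functions, since the domain is separable; composing them
  with \<open>f\<close> gives simple functions again, whatever the target space.
\<close>

lemma strongly_measurable_continuous_on_open:
  fixes f :: "'b::euclidean_space \<Rightarrow> 'a::real_normed_vector"
  assumes "open U" "continuous_on U f"
  shows "strongly_measurable (lebesgue_on U) f"
proof -
  have "(\<lambda>x. x) \<in> borel_measurable (lebesgue_on U)"
    using assms(1) by (intro continuous_imp_measurable_on_sets_lebesgue) auto
  then obtain s where s: "\<And>i. simple_function (lebesgue_on U) (s i)"
    "\<And>x. x \<in> space (lebesgue_on U) \<Longrightarrow> (\<lambda>i. s i x) \<longlonglongrightarrow> x"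
    using borel_measurable_implies_sequence_metric by blast
  show ?thesis
    unfolding strongly_measurable_def
  proof (intro exI[of _ "\<lambda>i x. f (s i x)"] conjI allI AE_I2 simple_function_compose1[OF s(1)])
    fix x assume x: "x \<in> space (lebesgue_on U)"
    then have "isCont f x"
      using assms by (auto simp: continuous_on_eq_continuous_at)
    then show "(\<lambda>i. f (s i x)) \<longlonglongrightarrow> f x"
      using s(2)[OF x] by (rule isCont_tendsto_compose)
  qed
qed

text \<open>
  In a non-separable space \<^term>\<open>f\<close> itself need not be Borel measurable, but its norm agrees almost
  everywhere with a limit of real simple functions. This is what makes the additivity and dominated
  convergence theorems for \<^const>\<open>nn_integral\<close> available.
\<close>

lemma strongly_measurable_norm:
  assumes "strongly_measurable M f"
  obtains n where "n \<in> borel_measurable M" "AE x in M. norm (f x) = n x"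
proof -
  obtain s where s: "\<And>i. simple_function M (s i)" "AE x in M. (\<lambda>i. s i x) \<longlonglongrightarrow> f x"
    using assms unfolding strongly_measurable_def by blast
  have "(\<lambda>x. norm (s i x)) \<in> borel_measurable M" for i
    by (intro borel_measurable_simple_function simple_function_compose1[OF s(1)])
  then have "(\<lambda>x. lim (\<lambda>i. norm (s i x))) \<in> borel_measurable M"
    by (rule borel_measurable_lim_metric)
  moreover have "AE x in M. norm (f x) = lim (\<lambda>i. norm (s i x))"
    using s(2) by eventually_elim (metis limI tendsto_norm)
  ultimately show thesis by (rule that)
qed

text \<open>
  The lower integral \<^const>\<open>nn_integral\<close> is not subadditive on arbitrary functions; strong
  measurability supplies measurable versions of the norms.
\<close>

lemma nn_integral_norm_triangle:
  assumes "strongly_measurable M f" "strongly_measurable M g" "strongly_measurable M h"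
  shows "(\<integral>\<^sup>+x. norm (f x - h x) \<partial>M) \<le> (\<integral>\<^sup>+x. norm (f x - g x) \<partial>M) + (\<integral>\<^sup>+x. norm (g x - h x) \<partial>M)"
proof -
  obtain m where m: "m \<in> borel_measurable M" "AE x in M. norm (f x - g x) = m x"
    by (rule strongly_measurable_norm[OF strongly_measurable_diff[OF assms(1,2)]])
  obtain n where n: "n \<in> borel_measurable M" "AE x in M. norm (g x - h x) = n x"
    by (rule strongly_measurable_norm[OF strongly_measurable_diff[OF assms(2,3)]])
  have "AE x in M. ennreal (norm (f x - h x)) \<le> ennreal (m x) + ennreal (n x)"
    using m(2) n(2)
  proof eventually_elim
    case (elim x)
    have "norm (f x - h x) \<le> m x + n x"
      using norm_triangle_ineq[of "f x - g x" "g x - h x"] elim by simp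
    moreover have "0 \<le> m x" "0 \<le> n x" using elim by (metis norm_ge_zero)+
    ultimately show ?case by (simp flip: ennreal_plus)
  qed
  then have "(\<integral>\<^sup>+x. norm (f x - h x) \<partial>M) \<le> (\<integral>\<^sup>+x. ennreal (m x) + ennreal (n x) \<partial>M)"
    by (rule nn_integral_mono_AE)
  also have "\<dots> = (\<integral>\<^sup>+x. m x \<partial>M) + (\<integral>\<^sup>+x. n x \<partial>M)"
    using m(1) n(1) by (intro nn_integral_add) auto
  also have "(\<integral>\<^sup>+x. m x \<partial>M) = (\<integral>\<^sup>+x. norm (f x - g x) \<partial>M)"
    using m(2) by (intro nn_integral_cong_AE) (auto elim!: eventually_mono)
  also have "(\<integral>\<^sup>+x. n x \<partial>M) = (\<integral>\<^sup>+x. norm (g x - h x) \<partial>M)"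
    using n(2) by (intro nn_integral_cong_AE) (auto elim!: eventually_mono)
  finally show ?thesis .
qed

section \<open>The Bochner integral of strongly measurable functions\<close>

lemma simple_bochner_integral_norm_diff_le:
  assumes s: "Bochner_Integration.simple_bochner_integrable M s"
    and t: "Bochner_Integration.simple_bochner_integrable M t"
  shows "ennreal (norm (Bochner_Integration.simple_bochner_integral M s
      - Bochner_Integration.simple_bochner_integral M t)) \<le> (\<integral>\<^sup>+x. norm (s x - t x) \<partial>M)"
proof -
  have d: "Bochner_Integration.simple_bochner_integrable M (\<lambda>x. s x - t x)"
    and n: "Bochner_Integration.simple_bochner_integrable M (\<lambda>x. norm (s x - t x))"
    by (rule simple_bochner_integrable_compose2[OF _ s t]; simp)+
  have "norm (Bochner_Integration.simple_bochner_integral M s - Bochner_Integration.simple_bochner_integral M t)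
      \<le> Bochner_Integration.simple_bochner_integral M (\<lambda>x. norm (s x - t x))"
    using simple_bochner_integral_norm_bound[OF d] simple_bochner_integral_diff[OF s t] by simp
  then show ?thesis
    using simple_bochner_integral_eq_nn_integral[OF n] by (metis ennreal_leI norm_ge_zero)
qed

lemma strongly_measurable_simple_bochner:
  "Bochner_Integration.simple_bochner_integrable M s \<Longrightarrow> strongly_measurable M s"
  by (auto elim: simple_bochner_integrable.cases intro: strongly_measurable_simple)

text \<open>
  This contraction estimate passes to the limit from simple functions. For equal functions it gives
  the uniqueness of the integral.
\<close>

lemma has_strong_bochner_integral_norm_diff_le:
  assumes "has_strong_bochner_integral M f u" "has_strong_bochner_integral M g v"
  shows "ennreal (norm (u - v)) \<le> (\<integral>\<^sup>+x. norm (f x - g x) \<partial>M)"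
proof -
  obtain s t where f: "strongly_measurable M f" and g: "strongly_measurable M g"
    and s: "\<And>i. Bochner_Integration.simple_bochner_integrable M (s i)"
      "(\<lambda>i. \<integral>\<^sup>+x. norm (f x - s i x) \<partial>M) \<longlonglongrightarrow> 0"
      "(\<lambda>i. Bochner_Integration.simple_bochner_integral M (s i)) \<longlonglongrightarrow> u"
    and t: "\<And>i. Bochner_Integration.simple_bochner_integrable M (t i)"
      "(\<lambda>i. \<integral>\<^sup>+x. norm (g x - t i x) \<partial>M) \<longlonglongrightarrow> 0"
      "(\<lambda>i. Bochner_Integration.simple_bochner_integral M (t i)) \<longlonglongrightarrow> v"
    using assms unfolding has_strong_bochner_integral_def by blast
  let ?b = "\<lambda>i. (\<integral>\<^sup>+x. norm (f x - s i x) \<partial>M)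
      + ((\<integral>\<^sup>+x. norm (f x - g x) \<partial>M) + (\<integral>\<^sup>+x. norm (g x - t i x) \<partial>M))"
  have "ennreal (norm (Bochner_Integration.simple_bochner_integral M (s i)
      - Bochner_Integration.simple_bochner_integral M (t i))) \<le> ?b i" for i
  proof -
    note ss = strongly_measurable_simple_bochner[OF s(1)[of i]]
    note tt = strongly_measurable_simple_bochner[OF t(1)[of i]]
    have "ennreal (norm (Bochner_Integration.simple_bochner_integral M (s i)
        - Bochner_Integration.simple_bochner_integral M (t i))) \<le> (\<integral>\<^sup>+x. norm (s i x - t i x) \<partial>M)"
      by (rule simple_bochner_integral_norm_diff_le[OF s(1) t(1)])
    also have "\<dots> \<le> (\<integral>\<^sup>+x. norm (s i x - f x) \<partial>M) + (\<integral>\<^sup>+x. norm (f x - t i x) \<partial>M)"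
      by (rule nn_integral_norm_triangle[OF ss f tt])
    also have "\<dots> \<le> ?b i"
      by (intro add_mono nn_integral_norm_triangle[OF f g tt]) (simp add: norm_minus_commute)
    finally show ?thesis .
  qed
  moreover have "(\<lambda>i. ennreal (norm (Bochner_Integration.simple_bochner_integral M (s i)
      - Bochner_Integration.simple_bochner_integral M (t i)))) \<longlonglongrightarrow> ennreal (norm (u - v))"
    by (intro tendsto_ennrealI tendsto_norm tendsto_diff s t)
  moreover have "?b \<longlonglongrightarrow> 0 + ((\<integral>\<^sup>+x. norm (f x - g x) \<partial>M) + 0)"
    by (intro tendsto_add s t tendsto_const)
  ultimately show ?thesis
    by (intro LIMSEQ_le[where X = "\<lambda>i. ennreal (norm (Bochner_Integration.simple_bochner_integral M (s i)
      - Bochner_Integration.simple_bochner_integral M (t i)))"]) auto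
qed

lemma strong_bochner_integral_eqI:
  assumes "has_strong_bochner_integral M f v"
  shows "strong_bochner_integral M f = v"
proof -
  have "u = v" if "has_strong_bochner_integral M f u" for u
    using has_strong_bochner_integral_norm_diff_le[OF that assms] by simp
  then have "(THE v. has_strong_bochner_integral M f v) = v"
    using assms by blast
  then show ?thesis
    using assms by (auto simp: strong_bochner_integral_def strong_bochner_integrable_def)
qed

text \<open>
  Bochner's criterion. A given approximating sequence of simple functions need not be dominated, so
  each \<open>s i\<close> is set to zero where its norm exceeds \<open>2 * norm f\<close>. This does not affect the pointwise
  limit, and the truncated functions are dominated by an integrable function.
\<close>

lemma strong_bochner_integrableI_bounded:
  fixes f :: "'a \<Rightarrow> 'b::banach"
  assumes f: "strongly_measurable M f" and fin: "(\<integral>\<^sup>+x. norm (f x) \<partial>M) < \<infinity>"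
  shows "strong_bochner_integrable M f"
proof -
  obtain s where s: "\<And>i. simple_function M (s i)" "AE x in M. (\<lambda>i. s i x) \<longlonglongrightarrow> f x"
    using f unfolding strongly_measurable_def by blast
  obtain n where n[measurable]: "n \<in> borel_measurable M" and fn: "AE x in M. norm (f x) = n x"
    using f by (rule strongly_measurable_norm)
  have [measurable]: "(\<lambda>x. norm (s i x)) \<in> borel_measurable M" for i
    by (intro borel_measurable_simple_function simple_function_compose1[OF s(1)])
  define r where "r i x = (if norm (s i x) \<le> 2 * n x then s i x else 0)" for i x
  have r: "simple_function M (r i)" for i
    unfolding r_def by (intro simple_function_If s(1) simple_function_const) measurable
  have finn: "(\<integral>\<^sup>+x. ennreal (n x) \<partial>M) < \<infinity>"
    using fin fn by (subst nn_integral_cong_AE[where v = "\<lambda>x. ennreal (norm (f x))"]) (auto elim!: eventually_mono)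
  have fin3: "(\<integral>\<^sup>+x. ennreal (3 * n x) \<partial>M) < \<infinity>"
    using finn by (simp add: ennreal_mult' nn_integral_cmult ennreal_mult_less_top)
  have r_le: "AE x in M. norm (r i x) \<le> 2 * n x" for i
    using fn by eventually_elim (auto simp: r_def, metis norm_ge_zero)
  have r_lim: "AE x in M. (\<lambda>i. norm (f x - r i x)) \<longlonglongrightarrow> 0"
    using s(2) fn
  proof eventually_elim
    case (elim x)
    have "(\<lambda>i. r i x) \<longlonglongrightarrow> f x"
    proof (cases "f x = 0")
      case True
      then have "r i x = 0" for i using elim(2) by (simp add: r_def)
      with True show ?thesis by simp
    next
      case False
      then have "norm (f x) < 2 * n x" using elim(2) zero_less_norm_iff[of "f x"] by linarith
      then have "eventually (\<lambda>i. norm (s i x) < 2 * n x) sequentially"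
        using elim by (intro order_tendstoD(2)[OF tendsto_norm]) auto
      then have "eventually (\<lambda>i. s i x = r i x) sequentially"
        by eventually_elim (simp add: r_def)
      then show ?thesis using elim(1) by (rule Lim_transform_eventually[rotated])
    qed
    then show ?case by (intro tendsto_norm_zero) (use tendsto_diff[OF tendsto_const, of "\<lambda>i. r i x" "f x" _ "f x"] in simp)
  qed
  have rb: "Bochner_Integration.simple_bochner_integrable M (r i)" for i
  proof (rule simple_bochner_integrableI_bounded[OF r])
    have "(\<integral>\<^sup>+x. norm (r i x) \<partial>M) \<le> (\<integral>\<^sup>+x. ennreal (3 * n x) \<partial>M)"
      using r_le[of i] fn
    proof (intro nn_integral_mono_AE, eventually_elim)
      case (elim x)
      then have "0 \<le> n x" by (metis norm_ge_zero)
      with elim show ?case by (intro ennreal_leI) linarith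
    qed
    then show "(\<integral>\<^sup>+x. norm (r i x) \<partial>M) < \<infinity>"
      using fin3 by (rule order_le_less_trans)
  qed
  have lim: "(\<lambda>i. \<integral>\<^sup>+x. norm (f x - r i x) \<partial>M) \<longlonglongrightarrow> 0"
  proof -
    have "\<exists>d. d \<in> borel_measurable M \<and> (AE x in M. norm (f x - r i x) = d x)" for i
      using strongly_measurable_norm[OF strongly_measurable_diff[OF f strongly_measurable_simple[OF r]]]
      by blast
    then obtain d where d[measurable]: "\<And>i. d i \<in> borel_measurable M"
      and fd: "\<And>i. AE x in M. norm (f x - r i x) = d i x" by metis
    have fd': "AE x in M. \<forall>i. norm (f x - r i x) = d i x"
      using fd by (simp add: AE_all_countable)
    have "(\<lambda>i. \<integral>\<^sup>+x. ennreal (d i x) \<partial>M) \<longlonglongrightarrow> (\<integral>\<^sup>+x. 0 \<partial>M)"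
    proof (rule nn_integral_dominated_convergence[where w = "\<lambda>x. ennreal (3 * n x)"])
      show "AE x in M. ennreal (d i x) \<le> ennreal (3 * n x)" for i
        using fd[of i] fn r_le[of i]
      proof eventually_elim
        case (elim x)
        have "norm (f x - r i x) \<le> norm (f x) + norm (r i x)" by (rule norm_triangle_ineq4)
        with elim show ?case by (intro ennreal_leI) linarith
      qed
      show "AE x in M. (\<lambda>i. ennreal (d i x)) \<longlonglongrightarrow> 0"
        using fd' r_lim by eventually_elim (auto intro: tendsto_ennrealI simp flip: ennreal_0)
    qed (use fin3 in auto)
    moreover have "(\<integral>\<^sup>+x. ennreal (d i x) \<partial>M) = (\<integral>\<^sup>+x. norm (f x - r i x) \<partial>M)" for i
      using fd[of i] by (intro nn_integral_cong_AE) (auto elim!: eventually_mono)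
    ultimately show ?thesis by simp
  qed
  have "Cauchy (\<lambda>i. Bochner_Integration.simple_bochner_integral M (r i))"
  proof (rule metric_CauchyI)
    fix e :: real assume "e > 0"
    then have "eventually (\<lambda>i. (\<integral>\<^sup>+x. norm (f x - r i x) \<partial>M) < ennreal (e / 2)) sequentially"
      by (intro order_tendstoD(2)[OF lim]) auto
    then obtain N where N: "\<And>i. i \<ge> N \<Longrightarrow> (\<integral>\<^sup>+x. norm (f x - r i x) \<partial>M) < ennreal (e / 2)"
      unfolding eventually_sequentially by blast
    show "\<exists>N. \<forall>i\<ge>N. \<forall>j\<ge>N. dist (Bochner_Integration.simple_bochner_integral M (r i))
        (Bochner_Integration.simple_bochner_integral M (r j)) < e"
    proof (intro exI[of _ N] allI impI)
      fix i j assume ij: "N \<le> i" "N \<le> j"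
      have "ennreal (norm (Bochner_Integration.simple_bochner_integral M (r i)
          - Bochner_Integration.simple_bochner_integral M (r j))) \<le> (\<integral>\<^sup>+x. norm (r i x - r j x) \<partial>M)"
        by (rule simple_bochner_integral_norm_diff_le[OF rb rb])
      also have "\<dots> \<le> (\<integral>\<^sup>+x. norm (r i x - f x) \<partial>M) + (\<integral>\<^sup>+x. norm (f x - r j x) \<partial>M)"
        by (intro nn_integral_norm_triangle f strongly_measurable_simple r)
      also have "\<dots> < ennreal (e / 2) + ennreal (e / 2)"
        using N[OF ij(1)] N[OF ij(2)] by (intro add_strict_mono) (simp_all add: norm_minus_commute)
      also have "\<dots> = ennreal e"
        using \<open>e > 0\<close> by (simp flip: ennreal_plus)
      finally show "dist (Bochner_Integration.simple_bochner_integral M (r i))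
          (Bochner_Integration.simple_bochner_integral M (r j)) < e"
        using \<open>e > 0\<close> by (simp add: dist_norm ennreal_less_iff)
    qed
  qed
  then obtain v where "(\<lambda>i. Bochner_Integration.simple_bochner_integral M (r i)) \<longlonglongrightarrow> v"
    using Cauchy_convergent_iff convergent_def by blast
  then show ?thesis
    unfolding strong_bochner_integrable_def has_strong_bochner_integral_def
    using f rb lim by blast
qed

lemma has_strong_bochner_integral_scaleR_left:
  fixes k :: "'a \<Rightarrow> real" and y :: "'b::real_normed_vector"
  assumes "has_bochner_integral M k I"
  shows "has_strong_bochner_integral M (\<lambda>x. k x *\<^sub>R y) (I *\<^sub>R y)"
proof -
  obtain s where k: "k \<in> borel_measurable M"
    and s: "\<And>i. Bochner_Integration.simple_bochner_integrable M (s i)"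
      "(\<lambda>i. \<integral>\<^sup>+x. norm (k x - s i x) \<partial>M) \<longlonglongrightarrow> 0"
      "(\<lambda>i. Bochner_Integration.simple_bochner_integral M (s i)) \<longlonglongrightarrow> I"
    using assms by cases blast
  have [measurable]: "s i \<in> borel_measurable M" for i
    using s(1)[of i] by (auto elim: simple_bochner_integrable.cases intro: borel_measurable_simple_function)
  note [measurable] = k
  show ?thesis
    unfolding has_strong_bochner_integral_def
  proof (intro conjI exI[of _ "\<lambda>i x. s i x *\<^sub>R y"] allI)
    show "strongly_measurable M (\<lambda>x. k x *\<^sub>R y)"
      by (rule strongly_measurable_scaleR_left[OF k])
    show "Bochner_Integration.simple_bochner_integrable M (\<lambda>x. s i x *\<^sub>R y)" for i
      by (rule simple_bochner_integrable_compose2[OF _ s(1) s(1), of "\<lambda>a _. a *\<^sub>R y"]) simp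
    have "(\<integral>\<^sup>+x. norm (k x *\<^sub>R y - s i x *\<^sub>R y) \<partial>M) = ennreal (norm y) * (\<integral>\<^sup>+x. norm (k x - s i x) \<partial>M)" for i
      by (subst nn_integral_cmult[symmetric])
        (auto simp: mult.commute ennreal_mult simp flip: scaleR_diff_left)
    moreover have "(\<lambda>i. ennreal (norm y) * (\<integral>\<^sup>+x. norm (k x - s i x) \<partial>M)) \<longlonglongrightarrow> ennreal (norm y) * 0"
      by (intro ennreal_tendsto_cmult s) auto
    ultimately show "(\<lambda>i. \<integral>\<^sup>+x. norm (k x *\<^sub>R y - s i x *\<^sub>R y) \<partial>M) \<longlonglongrightarrow> 0" by simp
    have "Bochner_Integration.simple_bochner_integral M (\<lambda>x. s i x *\<^sub>R y)
        = Bochner_Integration.simple_bochner_integral M (s i) *\<^sub>R y" for i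
      by (rule simple_bochner_integral_linear[OF _ s(1)])
        (auto intro: bounded_linear.linear bounded_linear_scaleR_left)
    then show "(\<lambda>i. Bochner_Integration.simple_bochner_integral M (\<lambda>x. s i x *\<^sub>R y)) \<longlonglongrightarrow> I *\<^sub>R y"
      by (auto intro!: tendsto_intros s)
  qed
qed

text \<open>
  All asymptotics below rest on this comparison of a vector-valued integrand with a scalar
  integrand times a fixed vector: the integral of the latter is explicit, and only real integrals
  remain to be computed.
\<close>

lemma strong_bochner_integral_close_to_scaleR:
  fixes f :: "'a \<Rightarrow> 'b::banach" and k b :: "'a \<Rightarrow> real"
  assumes f: "strongly_measurable M f"
    and k: "has_bochner_integral M k I" and b: "has_bochner_integral M b B"
    and le: "\<And>x. x \<in> space M \<Longrightarrow> norm (f x - k x *\<^sub>R y) \<le> b x"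
  shows "strong_bochner_integrable M f" (is ?integrable)
    and "norm (strong_bochner_integral M f - I *\<^sub>R y) \<le> B" (is ?bound)
proof -
  have bnn: "0 \<le> b x" if "x \<in> space M" for x
    using le[OF that] norm_ge_zero order_trans by blast
  have B: "(\<integral>\<^sup>+x. ennreal (b x) \<partial>M) = ennreal B"
    using b bnn by (simp add: has_bochner_integral_iff nn_integral_eq_integral AE_I2)
  have "integrable M (\<lambda>x. \<bar>k x\<bar> * norm y)"
    using k by (simp add: has_bochner_integral_iff)
  then have kf: "(\<integral>\<^sup>+x. ennreal (norm (k x *\<^sub>R y)) \<partial>M) < \<infinity>"
    unfolding integrable_iff_bounded by (simp add: abs_mult)
  have "(\<integral>\<^sup>+x. norm (f x) \<partial>M) \<le> (\<integral>\<^sup>+x. ennreal (norm (k x *\<^sub>R y)) + ennreal (b x) \<partial>M)"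
  proof (intro nn_integral_mono)
    fix x assume x: "x \<in> space M"
    have "norm (f x) \<le> norm (k x *\<^sub>R y) + b x"
      using le[OF x] norm_triangle_sub[of "f x" "k x *\<^sub>R y"] by linarith
    then show "ennreal (norm (f x)) \<le> ennreal (norm (k x *\<^sub>R y)) + ennreal (b x)"
      using bnn[OF x] by (simp add: ennreal_leI flip: ennreal_plus)
  qed
  also have "\<dots> = (\<integral>\<^sup>+x. ennreal (norm (k x *\<^sub>R y)) \<partial>M) + ennreal B"
    unfolding B[symmetric]
    using k b by (intro nn_integral_add) (auto simp: has_bochner_integral_iff)
  also have "\<dots> < \<infinity>" using kf by simp
  finally show ?integrable
    by (rule strong_bochner_integrableI_bounded[OF f])
  then obtain v where v: "has_strong_bochner_integral M f v"
    unfolding strong_bochner_integrable_def by blast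
  have "ennreal (norm (v - I *\<^sub>R y)) \<le> (\<integral>\<^sup>+x. norm (f x - k x *\<^sub>R y) \<partial>M)"
    by (rule has_strong_bochner_integral_norm_diff_le[OF v has_strong_bochner_integral_scaleR_left[OF k]])
  also have "\<dots> \<le> ennreal B"
    unfolding B[symmetric] using le by (intro nn_integral_mono ennreal_leI)
  finally have "ennreal (norm (v - I *\<^sub>R y)) \<le> ennreal B" .
  moreover have "0 \<le> B"
    using b bnn by (auto simp: has_bochner_integral_iff intro!: integral_nonneg_AE AE_I2)
  ultimately have "norm (v - I *\<^sub>R y) \<le> B" by simp
  then show ?bound
    using strong_bochner_integral_eqI[OF v] by simp
qed


section \<open>Continuity of strongly measurable semigroups\<close>

text \<open>
  Steinhaus' theorem. By regularity choose a compact \<open>T \<subseteq> K\<close> of positive measure and an open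
  \<open>U \<supseteq> T\<close> with \<open>U - T\<close> smaller in measure than \<open>T\<close>. A sufficiently small translate of \<open>T\<close> stays in
  \<open>U\<close>, hence does not fit into \<open>U - T\<close> and has to meet \<open>T\<close>.
\<close>

lemma difference_set_contains_ball:
  fixes K :: "'a::euclidean_space set"
  assumes K: "K \<in> sets lebesgue" "bounded K" and pos: "emeasure lebesgue K \<noteq> 0"
  obtains \<delta> where "\<delta> > 0" "\<And>h. norm h < \<delta> \<Longrightarrow> \<exists>x\<in>K. x + h \<in> K"
proof -
  have Km: "K \<in> lmeasurable"
    using K by (simp add: bounded_set_imp_lmeasurable)
  define e where "e = measure lebesgue K"
  have "e > 0"
    using pos Km by (simp add: e_def emeasure_eq_measure2 less_le)
  then obtain T where T: "closed T" "T \<subseteq> K" "K - T \<in> lmeasurable" "emeasure lebesgue (K - T) < ennreal e"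
    using sets_lebesgue_inner_closed[OF K(1)] by metis
  have "compact T"
    using T K by (meson bounded_subset compact_eq_bounded_closed)
  then have Tm: "T \<in> lmeasurable" by (rule lmeasurable_compact)
  have "measure lebesgue (K - T) < e"
    using T(3,4) \<open>e > 0\<close> by (simp add: emeasure_eq_measure2 ennreal_less_iff)
  moreover have "measure lebesgue (K - T) = e - measure lebesgue T"
    unfolding e_def using Km Tm T(2) by (rule measurable_measure_Diff[OF _ fmeasurableD])
  ultimately have Tpos: "measure lebesgue T > 0" by simp
  then obtain U where U: "open U" "T \<subseteq> U" "U - T \<in> lmeasurable"
      "emeasure lebesgue (U - T) < ennreal (measure lebesgue T)"
    using sets_lebesgue_outer_open[OF fmeasurableD[OF Tm]] by metis
  have UT: "measure lebesgue (U - T) < measure lebesgue T"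
    using U(3,4) Tpos by (simp add: emeasure_eq_measure2 ennreal_less_iff)
  have "closed (- U)" "T \<inter> - U = {}"
    using U(1,2) by auto
  then obtain \<delta> where \<delta>: "\<delta> > 0" "\<And>x y. x \<in> T \<Longrightarrow> y \<in> - U \<Longrightarrow> \<delta> \<le> dist x y"
    using separate_compact_closed[OF \<open>compact T\<close>] by metis
  have "\<exists>x\<in>K. x + h \<in> K" if h: "norm h < \<delta>" for h
  proof (rule ccontr)
    assume no: "\<not> (\<exists>x\<in>K. x + h \<in> K)"
    have "(+) h ` T \<subseteq> U - T"
    proof
      fix z assume "z \<in> (+) h ` T"
      then obtain x where x: "x \<in> T" "z = x + h" by (auto simp: add.commute)
      then have "dist x z < \<delta>" using h by (simp add: dist_norm)
      then have "z \<in> U" using \<delta>(2)[OF x(1), of z] by force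
      then show "z \<in> U - T" using x no T(2) by blast
    qed
    then have "measure lebesgue ((+) h ` T) \<le> measure lebesgue (U - T)"
      using U(3) measurable_translation[OF Tm] by (intro measure_mono_fmeasurable) auto
    then show False using UT by (simp add: measure_translation)
  qed
  with \<delta>(1) show thesis by (rule that)
qed

text \<open>
  A weak form of Lusin's theorem. The values of the approximating simple functions form a countable
  set, and almost every \<open>f x\<close> is within \<open>e\<close> of one of them; one of countably many sets covering \<open>A\<close>
  up to a null set must have positive measure.
\<close>

lemma strongly_measurable_nearly_constant:
  assumes f: "strongly_measurable M f" and A: "A \<in> sets M" "emeasure M A \<noteq> 0" and e: "e > (0::real)"
  obtains K y where "K \<in> sets M" "K \<subseteq> A" "emeasure M K \<noteq> 0" "\<And>x. x \<in> K \<Longrightarrow> norm (f x - y) \<le> e"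
proof -
  obtain s where s: "\<And>i. simple_function M (s i)" "AE x in M. (\<lambda>i. s i x) \<longlonglongrightarrow> f x"
    using f unfolding strongly_measurable_def by blast
  obtain N where N: "{x \<in> space M. \<not> (\<lambda>i. s i x) \<longlonglongrightarrow> f x} \<subseteq> N" "N \<in> null_sets M"
    using s(2) unfolding eventually_ae_filter by blast
  define Y where "Y = (\<Union>i. s i ` space M)"
  have "countable Y"
    unfolding Y_def by (intro countable_UN[OF countableI_type] countable_finite simple_functionD(1)[OF s(1)])
  define E where "E i y = {x \<in> A. \<forall>j\<ge>i. norm (s j x - y) \<le> e}" for i :: nat and y
  have [measurable]: "(\<lambda>x. norm (s j x - y)) \<in> borel_measurable M" for j y
    by (intro borel_measurable_simple_function simple_function_compose1[OF s(1)])
  note [measurable] = A(1)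
  have E[measurable]: "E i y \<in> sets M" for i y
  proof -
    have "E i y = {x \<in> space M. x \<in> A \<and> (\<forall>j. i \<le> j \<longrightarrow> norm (s j x - y) \<le> e)}"
      using sets.sets_into_space[OF A(1)] by (auto simp: E_def)
    then show ?thesis by simp
  qed
  have cover: "A - N \<subseteq> (\<Union>i. \<Union>y\<in>Y. E i y)"
  proof
    fix x assume x: "x \<in> A - N"
    then have xM: "x \<in> space M" using sets.sets_into_space[OF A(1)] by auto
    then have "Cauchy (\<lambda>i. s i x)" using x N(1) LIMSEQ_imp_Cauchy by blast
    then obtain i where i: "\<And>j k. j \<ge> i \<Longrightarrow> k \<ge> i \<Longrightarrow> norm (s j x - s k x) < e"
      using e unfolding Cauchy_iff by blast
    then have "x \<in> E i (s i x)" using x by (auto simp: E_def less_imp_le)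
    then show "x \<in> (\<Union>i. \<Union>y\<in>Y. E i y)" using xM by (auto simp: Y_def)
  qed
  have "\<exists>i. \<exists>y\<in>Y. E i y \<notin> null_sets M"
  proof (rule ccontr)
    assume "\<not> ?thesis"
    then have "(\<Union>i. \<Union>y\<in>Y. E i y) \<in> null_sets M"
      using \<open>countable Y\<close> by (intro null_sets_UN null_sets_UN') auto
    then have "(\<Union>i. \<Union>y\<in>Y. E i y) \<union> N \<in> null_sets M" using N(2) by auto
    then have "A \<in> null_sets M" using cover by (intro null_sets_subset[OF _ A(1)]) auto
    then show False using A(2) by auto
  qed
  then obtain i y where iy: "E i y \<notin> null_sets M" by blast
  show thesis
  proof
    show "E i y - N \<in> sets M" "E i y - N \<subseteq> A"
      using N(2) by (auto simp: E_def[symmetric]) (auto simp: E_def)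
    show "emeasure M (E i y - N) \<noteq> 0"
      using iy E N(2) by (auto simp: emeasure_Diff_null_set null_sets_def)
    fix x assume x: "x \<in> E i y - N"
    then have xA: "x \<in> A" by (simp add: E_def)
    then have "(\<lambda>j. s j x) \<longlonglongrightarrow> f x"
      using x N(1) sets.sets_into_space[OF A(1)] by blast
    then have "(\<lambda>j. norm (s j x - y)) \<longlonglongrightarrow> norm (f x - y)"
      by (intro tendsto_intros)
    then show "norm (f x - y) \<le> e"
      using x by (intro LIMSEQ_le_const2) (auto simp: E_def)
  qed
qed

text \<open>
  For \<open>0 \<le> r \<le> t\<close> the semigroup law gives
  \<open>S u x - S t x = S (t - r) (S (r + (u - t)) x - S r x)\<close>, so it suffices to find, for each \<open>u\<close> near
  \<open>t\<close>, a single \<open>r\<close> for which the inner difference is small. Choose a set \<open>K \<subseteq> {0..t}\<close> of positive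
  measure on which the orbit is nearly constant; by Steinhaus' theorem some \<open>r\<close> has both \<open>r\<close> and
  \<open>r + (u - t)\<close> in \<open>K\<close>.
\<close>

lemma semigroup_orbit_continuous:
  fixes S :: "real \<Rightarrow> 'a::real_normed_vector \<Rightarrow> 'a"
  assumes lin: "\<And>t. t \<ge> 0 \<Longrightarrow> bounded_linear (S t)"
    and add: "\<And>t r. t \<ge> 0 \<Longrightarrow> r \<ge> 0 \<Longrightarrow> S (t + r) = S t \<circ> S r"
    and meas: "strongly_measurable (lebesgue_on {0..}) (\<lambda>t. S t x)"
    and bound: "\<And>t y. t \<ge> 0 \<Longrightarrow> norm (S t y) \<le> M * norm y"
    and t: "t > 0"
  shows "isCont (\<lambda>t. S t x) t"
  unfolding isCont_def
proof (rule LIM_I)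
  fix e :: real assume e: "e > 0"
  \<comment> \<open>Two values within \<open>e'\<close> of a common point differ by at most \<open>2 * e'\<close>, which \<open>S (t - r)\<close> stretches by at most \<open>M\<close>.\<close>
  define e' where "e' = e / (2 * (\<bar>M\<bar> + 1))"
  have e': "e' > 0" using e by (simp add: e'_def)
  have "{0..t} \<in> sets (lebesgue_on {0..})"
    by (auto simp: sets_restrict_space_iff)
  moreover have "emeasure (lebesgue_on {0..}) {0..t} \<noteq> 0"
    using t by (simp add: emeasure_restrict_space)
  ultimately obtain K y where K: "K \<in> sets (lebesgue_on {0..})" "K \<subseteq> {0..t}"
      "emeasure (lebesgue_on {0..}) K \<noteq> 0" and Ky: "\<And>r. r \<in> K \<Longrightarrow> norm (S r x - y) \<le> e'"
    using strongly_measurable_nearly_constant[OF meas _ _ e'] by metis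
  have "K \<in> sets lebesgue" "emeasure lebesgue K \<noteq> 0"
    using K by (auto simp: sets_restrict_space_iff emeasure_restrict_space)
  moreover have "bounded K" using K(2) bounded_closed_interval bounded_subset by blast
  ultimately obtain \<delta> where \<delta>: "\<delta> > 0" "\<And>h. norm h < \<delta> \<Longrightarrow> \<exists>r\<in>K. r + h \<in> K"
    using difference_set_contains_ball by metis
  show "\<exists>d>0. \<forall>u. u \<noteq> t \<and> norm (u - t) < d \<longrightarrow> norm (S u x - S t x) < e"
  proof (intro exI[of _ \<delta>] conjI allI impI \<delta>(1))
    fix u assume "u \<noteq> t \<and> norm (u - t) < \<delta>"
    then obtain r where r: "r \<in> K" "r + (u - t) \<in> K" using \<delta>(2) by blast
    then have r0: "0 \<le> r" "r \<le> t" "0 \<le> r + (u - t)" using K(2) by auto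
    have "S u = S (t - r) \<circ> S (r + (u - t))" "S t = S (t - r) \<circ> S r"
      using add[of "t - r" "r + (u - t)"] add[of "t - r" r] r0 by auto
    then have "S u x - S t x = S (t - r) (S (r + (u - t)) x - S r x)"
      using lin[of "t - r"] r0 by (simp add: bounded_linear.linear linear_diff)
    also have "norm \<dots> \<le> M * norm (S (r + (u - t)) x - S r x)"
      using bound r0 by simp
    also have "\<dots> \<le> \<bar>M\<bar> * (2 * e')"
    proof (intro mult_mono)
      show "norm (S (r + (u - t)) x - S r x) \<le> 2 * e'"
        using Ky[OF r(1)] Ky[OF r(2)] norm_triangle_ineq4[of "S (r + (u - t)) x - y" "S r x - y"] by simp
    qed auto
    also have "\<dots> < e"
      using e by (simp add: e'_def field_simps)
    finally show "norm (S u x - S t x) < e" .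
  qed
qed

text \<open>
  The uniform bound makes the operators equicontinuous, so the vector argument can be frozen at its
  limit \<open>y0\<close>, where only the continuity of one orbit matters.
\<close>

lemma semigroup_jointly_continuous:
  fixes S :: "real \<Rightarrow> 'a::real_normed_vector \<Rightarrow> 'a"
  assumes lin: "\<And>t. t \<ge> 0 \<Longrightarrow> bounded_linear (S t)"
    and cont: "\<And>t x. t > 0 \<Longrightarrow> isCont (\<lambda>t. S t x) t"
    and bound: "\<And>t y. t \<ge> 0 \<Longrightarrow> norm (S t y) \<le> M * norm y"
    and a: "(a \<longlongrightarrow> a0) F" "a0 > 0" and y: "(y \<longlongrightarrow> y0) F"
  shows "((\<lambda>\<tau>. S (a \<tau>) (y \<tau>)) \<longlongrightarrow> S a0 y0) F"
proof (rule Lim_transform)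
  show "((\<lambda>\<tau>. S (a \<tau>) y0) \<longlongrightarrow> S a0 y0) F"
    using cont[OF a(2)] a(1) by (rule isCont_tendsto_compose)
  have "((\<lambda>\<tau>. M * norm (y \<tau> - y0)) \<longlongrightarrow> M * norm (y0 - y0)) F"
    by (intro tendsto_intros y)
  then have lim: "((\<lambda>\<tau>. M * norm (y \<tau> - y0)) \<longlongrightarrow> 0) F" by simp
  have "\<forall>\<^sub>F \<tau> in F. norm (S (a \<tau>) (y \<tau>) - S (a \<tau>) y0) \<le> M * norm (y \<tau> - y0)"
    using order_tendstoD(1)[OF a]
  proof eventually_elim
    case (elim \<tau>)
    then have "S (a \<tau>) (y \<tau>) - S (a \<tau>) y0 = S (a \<tau>) (y \<tau> - y0)"
      using lin[of "a \<tau>"] by (simp add: bounded_linear.linear linear_diff)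
    with bound[of "a \<tau>" "y \<tau> - y0"] elim show ?case by simp
  qed
  then show "((\<lambda>\<tau>. S (a \<tau>) (y \<tau>) - S (a \<tau>) y0) \<longlongrightarrow> 0) F"
    using lim by (rule Lim_null_comparison)
qed


section \<open>Kernels on the half line\<close>

text \<open>
  The majorants below behave differently near \<open>0\<close> and near infinity, with \<open>1\<close> as the cut.
\<close>

lemma has_bochner_integral_glue_at_1:
  fixes p q :: "real \<Rightarrow> real"
  assumes p: "(p has_integral I) {0..1}" and q: "(q has_integral J) {1..}"
    and p0: "\<And>x. 0 < x \<Longrightarrow> x \<le> 1 \<Longrightarrow> 0 \<le> p x" and q0: "\<And>x. 1 < x \<Longrightarrow> 0 \<le> q x"
  shows "has_bochner_integral (lebesgue_on {0<..}) (\<lambda>x. if x \<le> 1 then p x else q x) (I + J)"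
proof -
  let ?f = "\<lambda>x. if x \<le> 1 then p x else q x"
  have "(?f has_integral I) {0..1}"
    using p by (rule has_integral_eq[rotated]) auto
  moreover have "(?f has_integral J) {1..}"
    by (rule has_integral_spike_finite[OF _ _ q, of "{1}"]) auto
  moreover have "{0..1::real} \<inter> {1..} = {1}" "{0..1::real} \<union> {1..} = {0..}" by auto
  ultimately have "(?f has_integral (I + J)) {0..}"
    using has_integral_Un[of ?f I "{0..1}" J "{1..}"] by simp
  moreover have "(?f has_integral (I + J)) {0..} \<longleftrightarrow> (?f has_integral (I + J)) {0<..}"
    by (rule has_integral_spike_set_eq) (auto intro: negligible_subset[of "{0}"])
  ultimately have f: "(?f has_integral (I + J)) {0<..}" by blast
  then have "?f absolutely_integrable_on {0<..}"
    using p0 q0 by (intro nonnegative_absolutely_integrable_1) (auto simp: integrable_on_def)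
  then have "integrable (lebesgue_on {0<..}) ?f"
    by (simp add: set_integrable_def integrable_restrict_space)
  then show ?thesis
    using lebesgue_integral_eq_integral[of "{0<..}" ?f] integral_unique[OF f]
    by (simp add: has_bochner_integral_iff)
qed

text \<open>
  The kernel is compared with \<open>\<tau> powr (\<epsilon> - 1)\<close> on \<open>(0, 1]\<close>, whose integral \<open>1 / \<epsilon>\<close> carries the whole
  singularity as \<open>\<epsilon>\<close> tends to \<open>0\<close>. The factor \<open>1 / (\<tau> + 1)\<close> is absorbed into the hypothesis on \<open>h\<close>: there,
  \<open>\<eta>\<close> measures the oscillation of \<open>h\<close> near \<open>0\<close> and is the only error amplified by \<open>1 / \<epsilon>\<close>, whereas the
  error \<open>L * \<tau>\<close> cancels the singularity of the kernel.
\<close>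

lemma singular_kernel_estimate:
  fixes h :: "real \<Rightarrow> 'a::banach"
  assumes cont: "continuous_on {0<..} h" and bdd: "\<And>\<tau>. 0 < \<tau> \<Longrightarrow> norm (h \<tau>) \<le> C"
    and near: "\<And>\<tau>. 0 < \<tau> \<Longrightarrow> \<tau> \<le> 1 \<Longrightarrow> norm ((1 / (\<tau> + 1)) *\<^sub>R h \<tau> - y) \<le> \<eta> + L * \<tau>"
    and pos: "0 \<le> \<eta>" "0 \<le> L" and \<epsilon>: "\<epsilon> \<in> {0<..<1}"
  defines "F \<equiv> \<lambda>\<tau>. (\<tau> powr (\<epsilon> - 1) / (\<tau> + 1)) *\<^sub>R h \<tau>"
  shows "strong_bochner_integrable (lebesgue_on {0<..}) F" (is ?integrable)
    and "norm (strong_bochner_integral (lebesgue_on {0<..}) F - (1 / \<epsilon>) *\<^sub>R y)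
      \<le> \<eta> / \<epsilon> + L + C / (1 - \<epsilon>)" (is ?bound)
proof -
  have C: "0 \<le> C" using bdd[of 1] norm_ge_zero[of "h 1"] by linarith
  have I0: "((\<lambda>x. x powr (\<epsilon> - 1)) has_integral 1 / \<epsilon>) {0..1}"
    using has_integral_powr_from_0[of "\<epsilon> - 1" 1] \<epsilon> by simp
  have I1: "((\<lambda>x. x powr (\<epsilon> - 2)) has_integral 1 / (1 - \<epsilon>)) {1..}"
    using has_integral_powr_to_inf[of "\<epsilon> - 2" 1] \<epsilon> by (simp add: field_simps minus_divide_right)
  have "has_bochner_integral (lebesgue_on {0<..}) (\<lambda>x. if x \<le> 1 then x powr (\<epsilon> - 1) else 0) (1 / \<epsilon> + 0)"
    by (rule has_bochner_integral_glue_at_1[OF I0]) auto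
  then have k: "has_bochner_integral (lebesgue_on {0<..}) (\<lambda>x. if x \<le> 1 then x powr (\<epsilon> - 1) else 0) (1 / \<epsilon>)"
    by simp
  have "((\<lambda>x. \<eta> * x powr (\<epsilon> - 1) + L) has_integral \<eta> * (1 / \<epsilon>) + L) {0..1}"
    using has_integral_add[OF has_integral_mult_right[OF I0, of \<eta>] has_integral_const_real[of L 0 1]] by simp
  from has_bochner_integral_glue_at_1[OF this has_integral_mult_right[OF I1, of C]]
  have b: "has_bochner_integral (lebesgue_on {0<..})
      (\<lambda>x. if x \<le> 1 then \<eta> * x powr (\<epsilon> - 1) + L else C * x powr (\<epsilon> - 2)) (\<eta> / \<epsilon> + L + C / (1 - \<epsilon>))"
    using pos C by simp
  have meas: "strongly_measurable (lebesgue_on {0<..}) F"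
    unfolding F_def
    by (intro strongly_measurable_continuous_on_open continuous_intros cont) auto
  have le: "norm (F x - (if x \<le> 1 then x powr (\<epsilon> - 1) else 0) *\<^sub>R y)
      \<le> (if x \<le> 1 then \<eta> * x powr (\<epsilon> - 1) + L else C * x powr (\<epsilon> - 2))"
    if "x \<in> space (lebesgue_on {0<..})" for x
  proof (cases "x \<le> 1")
    case True
    have x: "0 < x" using that by simp
    have "F x - x powr (\<epsilon> - 1) *\<^sub>R y = x powr (\<epsilon> - 1) *\<^sub>R ((1 / (x + 1)) *\<^sub>R h x - y)"
      by (simp add: F_def scaleR_diff_right)
    then have "norm (F x - x powr (\<epsilon> - 1) *\<^sub>R y) = x powr (\<epsilon> - 1) * norm ((1 / (x + 1)) *\<^sub>R h x - y)"
      by simp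
    also have "\<dots> \<le> x powr (\<epsilon> - 1) * (\<eta> + L * x)"
      using near[OF x True] by (intro mult_left_mono) auto
    also have "\<dots> = \<eta> * x powr (\<epsilon> - 1) + L * x powr \<epsilon>"
      using x powr_mult_base[of x "\<epsilon> - 1"] by (simp add: algebra_simps)
    also have "\<dots> \<le> \<eta> * x powr (\<epsilon> - 1) + L"
      using pos(2) x True \<epsilon> powr_le1[of \<epsilon> x] by (simp add: mult_left_le)
    finally show ?thesis using True by simp
  next
    case False
    then have x: "1 < x" by simp
    have "norm (F x) = x powr (\<epsilon> - 1) / (x + 1) * norm (h x)"
      using x by (simp add: F_def)
    also have "\<dots> \<le> x powr (\<epsilon> - 1) / x * C"
      using x bdd[of x] by (intro mult_mono divide_left_mono) auto
    also have "x powr (\<epsilon> - 1) / x = x powr (\<epsilon> - 2)"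
      using x powr_mult_base[of x "\<epsilon> - 2"] by (simp add: field_simps)
    finally show ?thesis using x by (simp add: mult.commute)
  qed
  show ?integrable ?bound
    by (rule strong_bochner_integral_close_to_scaleR[OF meas k b le]; assumption)+
qed

lemma sin_pi_over_pi_tendsto:
  "((\<lambda>\<epsilon>. sin (pi * \<epsilon>) / pi / \<epsilon>) \<longlongrightarrow> 1) (at 0 within A)"
  "((\<lambda>\<epsilon>. sin (pi * \<epsilon>) / pi) \<longlongrightarrow> 0) (at 0 within A)"
proof -
  have "((\<lambda>\<epsilon>. sin (pi * \<epsilon>) / pi) has_real_derivative 1) (at 0 within A)"
    by (auto intro!: derivative_eq_intros)
  then show "((\<lambda>\<epsilon>. sin (pi * \<epsilon>) / pi / \<epsilon>) \<longlongrightarrow> 1) (at 0 within A)"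
    by (simp add: has_field_derivative_iff)
  have "((\<lambda>\<epsilon>. sin (pi * \<epsilon>) / pi) \<longlongrightarrow> sin (pi * 0) / pi) (at 0 within A)"
    by (intro tendsto_intros) auto
  then show "((\<lambda>\<epsilon>. sin (pi * \<epsilon>) / pi) \<longlongrightarrow> 0) (at 0 within A)" by simp
qed

lemma sin_pi_over_pi_nonneg:
  assumes "\<epsilon> \<in> {0<..<1}"
  shows "0 \<le> sin (pi * \<epsilon>) / pi"
  using assms by (intro divide_nonneg_pos sin_ge_zero) auto

text \<open>
  The normalised kernels form an approximate identity at \<open>0\<close>. Multiplying the preceding estimate
  by \<open>sin (pi * \<epsilon>) / pi\<close>, which is asymptotic to \<open>\<epsilon>\<close>, leaves \<open>\<eta>\<close> in the limit, and \<open>\<eta>\<close> is arbitrary.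
\<close>

lemma singular_kernel_concentrates_at_0:
  fixes h :: "real \<Rightarrow> 'a::banach"
  assumes cont: "continuous_on {0<..} h" and bdd: "\<And>\<tau>. 0 < \<tau> \<Longrightarrow> norm (h \<tau>) \<le> C"
    and lim: "(h \<longlongrightarrow> y) (at_right 0)"
  defines "F \<equiv> \<lambda>\<epsilon> \<tau>. (\<tau> powr (\<epsilon> - 1) / (\<tau> + 1)) *\<^sub>R h \<tau>"
  shows "\<forall>\<epsilon>\<in>{0<..<1}. strong_bochner_integrable (lebesgue_on {0<..}) (F \<epsilon>)"
    and "((\<lambda>\<epsilon>. (sin (pi * \<epsilon>) / pi) *\<^sub>R strong_bochner_integral (lebesgue_on {0<..}) (F \<epsilon>))
      \<longlongrightarrow> y) (at 0 within {0<..<1})"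
proof -
  have ex: "\<exists>L\<ge>0. \<forall>\<tau>>0. norm ((1 / (\<tau> + 1)) *\<^sub>R h \<tau> - y) \<le> \<eta> + L * \<tau>" if \<eta>: "\<eta> > 0" for \<eta>
  proof -
    have "((\<lambda>\<tau>. (1 / (\<tau> + 1)) *\<^sub>R h \<tau>) \<longlongrightarrow> (1 / (0 + 1)) *\<^sub>R y) (at_right 0)"
      by (intro tendsto_intros lim) auto
    then have "eventually (\<lambda>\<tau>. norm ((1 / (\<tau> + 1)) *\<^sub>R h \<tau> - y) < \<eta>) (at_right 0)"
      using \<eta> by (simp add: tendsto_iff dist_norm)
    then obtain \<delta> where \<delta>: "\<delta> > 0" "\<And>\<tau>. 0 < \<tau> \<Longrightarrow> \<tau> < \<delta> \<Longrightarrow> norm ((1 / (\<tau> + 1)) *\<^sub>R h \<tau> - y) < \<eta>"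
      unfolding eventually_at_right_field by auto
    have C: "0 \<le> C" using bdd[of 1] norm_ge_zero[of "h 1"] by linarith
    \<comment> \<open>Beyond \<open>\<delta>\<close> the trivial bound \<open>C + norm y\<close> is at most \<open>(C + norm y) / \<delta> * \<tau>\<close>.\<close>
    show ?thesis
    proof (intro exI[of _ "(C + norm y) / \<delta>"] conjI allI impI)
      show "0 \<le> (C + norm y) / \<delta>" using C \<delta> by simp
      fix \<tau> :: real assume \<tau>: "0 < \<tau>"
      show "norm ((1 / (\<tau> + 1)) *\<^sub>R h \<tau> - y) \<le> \<eta> + (C + norm y) / \<delta> * \<tau>"
      proof (cases "\<tau> < \<delta>")
        case True
        have "0 \<le> (C + norm y) / \<delta> * \<tau>" using C \<delta>(1) \<tau> by simp
        with \<delta>(2)[OF \<tau> True] show ?thesis by linarith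
      next
        case False
        have "norm ((1 / (\<tau> + 1)) *\<^sub>R h \<tau> - y) \<le> norm ((1 / (\<tau> + 1)) *\<^sub>R h \<tau>) + norm y"
          by (rule norm_triangle_ineq4)
        also have "norm ((1 / (\<tau> + 1)) *\<^sub>R h \<tau>) \<le> 1 * norm (h \<tau>)"
          unfolding norm_scaleR using \<tau> by (intro mult_right_mono) auto
        also have "1 * norm (h \<tau>) \<le> C" using bdd[OF \<tau>] by simp
        also have "C + norm y \<le> (C + norm y) / \<delta> * \<tau>"
          using False \<delta>(1) C mult_left_mono[of \<delta> \<tau> "C + norm y"] by (simp add: field_simps)
        finally show ?thesis using \<eta> by simp
      qed
    qed
  qed
  show int: "\<forall>\<epsilon>\<in>{0<..<1}. strong_bochner_integrable (lebesgue_on {0<..}) (F \<epsilon>)"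
  proof
    fix \<epsilon> :: real assume \<epsilon>: "\<epsilon> \<in> {0<..<1}"
    obtain L where "L \<ge> 0" "\<forall>\<tau>>0. norm ((1 / (\<tau> + 1)) *\<^sub>R h \<tau> - y) \<le> 1 + L * \<tau>"
      using ex[of 1] by auto
    then show "strong_bochner_integrable (lebesgue_on {0<..}) (F \<epsilon>)"
      unfolding F_def using \<epsilon> by (intro singular_kernel_estimate(1)[OF cont bdd, of y 1 L]) auto
  qed
  let ?\<sigma> = "\<lambda>\<epsilon>::real. sin (pi * \<epsilon>) / pi"
  let ?I = "\<lambda>\<epsilon>. strong_bochner_integral (lebesgue_on {0<..}) (F \<epsilon>)"
  show "((\<lambda>\<epsilon>. ?\<sigma> \<epsilon> *\<^sub>R ?I \<epsilon>) \<longlongrightarrow> y) (at 0 within {0<..<1})"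
  proof (rule tendstoI)
    fix e :: real assume e: "e > 0"
    obtain L where L: "L \<ge> 0" "\<forall>\<tau>>0. norm ((1 / (\<tau> + 1)) *\<^sub>R h \<tau> - y) \<le> e / 2 + L * \<tau>"
      using ex[of "e / 2"] e by auto
    let ?b = "\<lambda>\<epsilon>. e / 2 * (?\<sigma> \<epsilon> / \<epsilon>) + ?\<sigma> \<epsilon> * (L + C / (1 - \<epsilon>)) + \<bar>?\<sigma> \<epsilon> / \<epsilon> - 1\<bar> * norm y"
    have "(?b \<longlongrightarrow> e / 2 * 1 + 0 * (L + C / (1 - 0)) + \<bar>1 - 1\<bar> * norm y) (at 0 within {0<..<1})"
      by (intro tendsto_intros sin_pi_over_pi_tendsto) auto
    then have "eventually (\<lambda>\<epsilon>. ?b \<epsilon> < e) (at 0 within {0<..<1})"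
      by (rule order_tendstoD(2)) (use e in simp)
    moreover have "eventually (\<lambda>\<epsilon>::real. \<epsilon> \<in> {0<..<1}) (at 0 within {0<..<1})"
      by (simp add: eventually_at_filter)
    ultimately show "eventually (\<lambda>\<epsilon>. dist (?\<sigma> \<epsilon> *\<^sub>R ?I \<epsilon>) y < e) (at 0 within {0<..<1})"
    proof eventually_elim
      case (elim \<epsilon>)
      have est: "norm (?I \<epsilon> - (1 / \<epsilon>) *\<^sub>R y) \<le> e / 2 / \<epsilon> + L + C / (1 - \<epsilon>)"
        unfolding F_def using L e elim(2)
        by (intro singular_kernel_estimate(2)[OF cont bdd]) auto
      have "?\<sigma> \<epsilon> *\<^sub>R ?I \<epsilon> - y = ?\<sigma> \<epsilon> *\<^sub>R (?I \<epsilon> - (1 / \<epsilon>) *\<^sub>R y) + (?\<sigma> \<epsilon> / \<epsilon> - 1) *\<^sub>R y"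
        by (simp add: scaleR_diff_right scaleR_diff_left)
      then have "norm (?\<sigma> \<epsilon> *\<^sub>R ?I \<epsilon> - y)
          \<le> norm (?\<sigma> \<epsilon> *\<^sub>R (?I \<epsilon> - (1 / \<epsilon>) *\<^sub>R y)) + norm ((?\<sigma> \<epsilon> / \<epsilon> - 1) *\<^sub>R y)"
        by (metis norm_triangle_ineq)
      also have "\<dots> = ?\<sigma> \<epsilon> * norm (?I \<epsilon> - (1 / \<epsilon>) *\<^sub>R y) + \<bar>?\<sigma> \<epsilon> / \<epsilon> - 1\<bar> * norm y"
        by (simp only: norm_scaleR abs_of_nonneg[OF sin_pi_over_pi_nonneg[OF elim(2)]])
      also have "\<dots> \<le> ?\<sigma> \<epsilon> * (e / 2 / \<epsilon> + L + C / (1 - \<epsilon>)) + \<bar>?\<sigma> \<epsilon> / \<epsilon> - 1\<bar> * norm y"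
        by (intro add_right_mono mult_left_mono est sin_pi_over_pi_nonneg elim(2))
      also have "\<dots> = ?b \<epsilon>"
        by (simp add: algebra_simps)
      also have "\<dots> < e" by (rule elim(1))
      finally show ?case by (simp add: dist_norm)
    qed
  qed
qed

text \<open>
  Here \<open>\<tau> powr (- \<epsilon>) / (\<tau> + 1)\<close> is harmless at \<open>0\<close> but its integral blows up like \<open>1 / \<epsilon>\<close> because of the
  tail. Exponential decay of \<open>h\<close> keeps the integrals bounded, and the prefactor tends to \<open>0\<close>.
\<close>

lemma decaying_kernel_vanishes:
  fixes h :: "real \<Rightarrow> 'a::banach"
  assumes cont: "continuous_on {0<..} h" and a: "0 < a"
    and decay: "\<And>\<tau>. 0 < \<tau> \<Longrightarrow> norm (h \<tau>) \<le> C * exp (- a * \<tau>)"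
  defines "F \<equiv> \<lambda>\<epsilon> \<tau>. (\<tau> powr (- \<epsilon>) / (\<tau> + 1)) *\<^sub>R h \<tau>"
  shows "\<forall>\<epsilon>\<in>{0<..<1}. strong_bochner_integrable (lebesgue_on {0<..}) (F \<epsilon>)"
    and "((\<lambda>\<epsilon>. (sin (pi * \<epsilon>) / pi) *\<^sub>R strong_bochner_integral (lebesgue_on {0<..}) (F \<epsilon>))
      \<longlongrightarrow> 0) (at 0 within {0<..<1})"
proof -
  have C: "0 \<le> C"
    using order_trans[OF norm_ge_zero decay[of 1]] by (simp add: zero_le_mult_iff)
  have est: "strong_bochner_integrable (lebesgue_on {0<..}) (F \<epsilon>) \<and>
      norm (strong_bochner_integral (lebesgue_on {0<..}) (F \<epsilon>) - 0 *\<^sub>R 0) \<le> C / (1 - \<epsilon>) + C * exp (- a) / a"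
    if \<epsilon>: "\<epsilon> \<in> {0<..<1}" for \<epsilon>
  proof -
    have "((\<lambda>x. C * x powr (- \<epsilon>)) has_integral C * (1 / (1 - \<epsilon>))) {0..1}"
      using has_integral_mult_right[OF has_integral_powr_from_0[of "- \<epsilon>" 1], of C] \<epsilon> by simp
    moreover have "((\<lambda>x. C * exp (- a * x)) has_integral C * (exp (- a) / a)) {1..}"
      using has_integral_mult_right[OF has_integral_exp_minus_to_infinity[OF a, of 1], of C] by simp
    ultimately have b: "has_bochner_integral (lebesgue_on {0<..})
        (\<lambda>x. if x \<le> 1 then C * x powr (- \<epsilon>) else C * exp (- a * x)) (C / (1 - \<epsilon>) + C * exp (- a) / a)"
      using has_bochner_integral_glue_at_1 C by fastforce
    have k: "has_bochner_integral (lebesgue_on {0<..}) (\<lambda>x::real. 0 :: real) 0"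
      by (rule has_bochner_integral_zero)
    have meas: "strongly_measurable (lebesgue_on {0<..}) (F \<epsilon>)"
      unfolding F_def
      by (intro strongly_measurable_continuous_on_open continuous_intros cont) auto
    have le: "norm (F \<epsilon> x - 0 *\<^sub>R 0) \<le> (if x \<le> 1 then C * x powr (- \<epsilon>) else C * exp (- a * x))"
      if "x \<in> space (lebesgue_on {0<..})" for x
    proof -
      have x: "0 < x" using that by simp
      have "norm (F \<epsilon> x) = x powr (- \<epsilon>) / (x + 1) * norm (h x)"
        using x by (simp add: F_def)
      also have "\<dots> \<le> x powr (- \<epsilon>) * (C * exp (- a * x))"
        using x decay[OF x] by (intro mult_mono) (auto simp: field_simps)
      also have "\<dots> \<le> (if x \<le> 1 then C * x powr (- \<epsilon>) else C * exp (- a * x))"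
      proof (cases "x \<le> 1")
        case True
        have "C * exp (- a * x) \<le> C * 1" using C a x by (intro mult_left_mono) auto
        then show ?thesis using True mult_left_mono[of "C * exp (- a * x)" C "x powr - \<epsilon>"]
          by (simp add: mult.commute)
      next
        case False
        have "x powr - \<epsilon> \<le> 1" using False \<epsilon> powr_mono[of "- \<epsilon>" 0 x] by simp
        then show ?thesis using False C mult_right_mono[of "x powr - \<epsilon>" 1 "C * exp (- a * x)"] by simp
      qed
      finally show ?thesis by simp
    qed
    show ?thesis
      using strong_bochner_integral_close_to_scaleR[OF meas k b le] by blast
  qed
  then show "\<forall>\<epsilon>\<in>{0<..<1}. strong_bochner_integrable (lebesgue_on {0<..}) (F \<epsilon>)" by blast
  have bt: "((\<lambda>\<epsilon>. sin (pi * \<epsilon>) / pi * (C / (1 - \<epsilon>) + C * exp (- a) / a))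
      \<longlongrightarrow> 0 * (C / (1 - 0) + C * exp (- a) / a)) (at 0 within {0<..<1})"
    by (intro tendsto_intros sin_pi_over_pi_tendsto) (use a in auto)
  show "((\<lambda>\<epsilon>. (sin (pi * \<epsilon>) / pi) *\<^sub>R strong_bochner_integral (lebesgue_on {0<..}) (F \<epsilon>))
      \<longlongrightarrow> 0) (at 0 within {0<..<1})"
  proof (rule Lim_null_comparison)
    show "\<forall>\<^sub>F \<epsilon> in at 0 within {0<..<1}.
        norm ((sin (pi * \<epsilon>) / pi) *\<^sub>R strong_bochner_integral (lebesgue_on {0<..}) (F \<epsilon>))
        \<le> sin (pi * \<epsilon>) / pi * (C / (1 - \<epsilon>) + C * exp (- a) / a)"
      unfolding eventually_at_filter
    proof (intro always_eventually allI impI)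
      fix \<epsilon> :: real assume \<epsilon>: "\<epsilon> \<in> {0<..<1}"
      have "norm ((sin (pi * \<epsilon>) / pi) *\<^sub>R strong_bochner_integral (lebesgue_on {0<..}) (F \<epsilon>))
          = sin (pi * \<epsilon>) / pi * norm (strong_bochner_integral (lebesgue_on {0<..}) (F \<epsilon>))"
        by (simp only: norm_scaleR abs_of_nonneg[OF sin_pi_over_pi_nonneg[OF \<epsilon>]])
      also have "\<dots> \<le> sin (pi * \<epsilon>) / pi * (C / (1 - \<epsilon>) + C * exp (- a) / a)"
        using est[OF \<epsilon>] sin_pi_over_pi_nonneg[OF \<epsilon>] by (intro mult_left_mono) auto
      finally show "norm ((sin (pi * \<epsilon>) / pi) *\<^sub>R strong_bochner_integral (lebesgue_on {0<..}) (F \<epsilon>))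
          \<le> sin (pi * \<epsilon>) / pi * (C / (1 - \<epsilon>) + C * exp (- a) / a)" .
    qed
  qed (use bt in simp)
qed

lemma exp_bounded_norm_le:
  assumes "strongly_measurable_semigroup S" "exp_bounded S M w" "0 \<le> t"
  shows "norm (S t x) \<le> M * exp (- w * t) * norm x"
proof -
  have "bounded_linear (S t)"
    using assms by (simp add: strongly_measurable_semigroup_def bounded_clinear_def)
  then have "norm (S t x) \<le> onorm (S t) * norm x" by (rule onorm)
  also have "\<dots> \<le> M * exp (- w * t) * norm x"
    using assms(2,3) by (intro mult_right_mono) (auto simp: exp_bounded_def)
  finally show ?thesis .
qed

theorem proposition4p7:
  fixes S :: "real \<Rightarrow> 'a::complex_banach \<Rightarrow> 'a"
    and D :: "'a set" and A :: "'a \<Rightarrow> 'a"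
    and g :: "real \<Rightarrow> 'a"
    and M\<^sub>0 w t\<^sub>0 :: real
  assumes "strongly_measurable_semigroup S"
    and "1 \<le> M\<^sub>0" and "0 \<le> w" and "exp_bounded S M\<^sub>0 w"
    and "infinitesimal_generator w S D (\<lambda>x. - A x)"
    and "continuous_on {..t\<^sub>0} g" and "bounded (g ` {..t\<^sub>0})"
  shows "(\<forall>t>t\<^sub>0.
      (\<forall>\<epsilon>\<in>{0<..<1}. strong_bochner_integrable (lebesgue_on {0<..})
        (\<lambda>\<tau>. (\<tau> powr (\<epsilon> - 1) / (\<tau> + 1)) *\<^sub>R
          S ((t - t\<^sub>0) * (\<tau> + 1)) (g (t\<^sub>0 - (t - t\<^sub>0) * \<tau>)))) \<and>
      ((\<lambda>\<epsilon>. (sin (pi * \<epsilon>) / pi) *\<^sub>R strong_bochner_integral (lebesgue_on {0<..})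
        (\<lambda>\<tau>. (\<tau> powr (\<epsilon> - 1) / (\<tau> + 1)) *\<^sub>R
          S ((t - t\<^sub>0) * (\<tau> + 1)) (g (t\<^sub>0 - (t - t\<^sub>0) * \<tau>))))
        \<longlongrightarrow> S (t - t\<^sub>0) (g t\<^sub>0)) (at 0 within {0<..<1}))
    \<and> (uniformly_exponentially_stable S \<longrightarrow> (\<forall>t>t\<^sub>0.
      (\<forall>\<epsilon>\<in>{0<..<1}. strong_bochner_integrable (lebesgue_on {0<..})
        (\<lambda>\<tau>. (\<tau> powr (- \<epsilon>) / (\<tau> + 1)) *\<^sub>R
          S ((t - t\<^sub>0) * (\<tau> + 1)) (g (t\<^sub>0 - (t - t\<^sub>0) * \<tau>)))) \<and>
      ((\<lambda>\<epsilon>. (sin (pi * \<epsilon>) / pi) *\<^sub>R strong_bochner_integral (lebesgue_on {0<..})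
        (\<lambda>\<tau>. (\<tau> powr (- \<epsilon>) / (\<tau> + 1)) *\<^sub>R
          S ((t - t\<^sub>0) * (\<tau> + 1)) (g (t\<^sub>0 - (t - t\<^sub>0) * \<tau>))))
        \<longlongrightarrow> 0) (at 0 within {0<..<1})))"
proof -
  obtain G where G: "\<And>r. r \<le> t\<^sub>0 \<Longrightarrow> norm (g r) \<le> G"
    using assms(7) unfolding bounded_iff by auto
  have G0: "0 \<le> G" using G[of t\<^sub>0] norm_ge_zero[of "g t\<^sub>0"] by linarith
  have lin: "bounded_linear (S t)" and add: "S (t + r) = S t \<circ> S r" if "t \<ge> 0" "r \<ge> 0" for t r
    using assms(1) that by (auto simp: strongly_measurable_semigroup_def bounded_clinear_def)
  have meas: "strongly_measurable (lebesgue_on {0..}) (\<lambda>t. S t x)" for x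
    using assms(1) by (auto simp: strongly_measurable_semigroup_def)
  have bound: "norm (S t x) \<le> M\<^sub>0 * norm x" if "t \<ge> 0" for t x
  proof -
    have "M\<^sub>0 * exp (- w * t) * norm x \<le> M\<^sub>0 * 1 * norm x"
      using assms(2,3) that by (intro mult_right_mono mult_left_mono) auto
    with exp_bounded_norm_le[OF assms(1,4) that, of x] show ?thesis by simp
  qed
  have orbit: "isCont (\<lambda>t. S t x) t" if "t > 0" for t x
    by (rule semigroup_orbit_continuous[OF _ _ meas bound that]) (use lin add in auto)
  \<comment> \<open>Both integrands have the form kernel times \<open>h (t - t\<^sub>0)\<close>; since \<open>c > 0\<close>, the semigroup is only evaluated
      at times \<open>\<ge> c\<close>, away from the possible discontinuity at \<open>0\<close>.\<close>
  define h where "h c \<tau> = S (c * (\<tau> + 1)) (g (t\<^sub>0 - c * \<tau>))" for c \<tau>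
  have h_cont: "continuous_on {0..} (h c)" if c: "c > 0" for c
    unfolding continuous_on_def
  proof
    fix \<tau> :: real assume \<tau>: "\<tau> \<in> {0..}"
    have "continuous_on {0..} (\<lambda>\<tau>. g (t\<^sub>0 - c * \<tau>))"
      using c by (intro continuous_on_compose2[OF assms(6)] continuous_intros) auto
    then have "((\<lambda>\<tau>. g (t\<^sub>0 - c * \<tau>)) \<longlongrightarrow> g (t\<^sub>0 - c * \<tau>)) (at \<tau> within {0..})"
      using \<tau> by (simp add: continuous_on_def)
    then show "(h c \<longlongrightarrow> h c \<tau>) (at \<tau> within {0..})"
      unfolding h_def using c \<tau>
      by (intro semigroup_jointly_continuous[OF lin orbit bound] tendsto_intros) auto
  qed
  have h_cont': "continuous_on {0<..} (h c)" if c: "c > 0" for c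
    by (rule continuous_on_subset[OF h_cont[OF c]]) auto
  have h_0: "(h c \<longlongrightarrow> S c (g t\<^sub>0)) (at_right 0)" if c: "c > 0" for c
  proof -
    have "(h c \<longlongrightarrow> h c 0) (at 0 within {0..})"
      using h_cont[OF c] by (simp add: continuous_on_def)
    then show ?thesis by (auto simp: h_def intro: tendsto_within_subset)
  qed
  have h_bound: "norm (h c \<tau>) \<le> M\<^sub>0 * G" if "c > 0" "\<tau> > 0" for c \<tau>
  proof -
    have "norm (h c \<tau>) \<le> M\<^sub>0 * norm (g (t\<^sub>0 - c * \<tau>))"
      unfolding h_def using that by (intro bound) auto
    also have "\<dots> \<le> M\<^sub>0 * G"
      using that assms(2) by (intro mult_left_mono G) auto
    finally show ?thesis .
  qed
  show ?thesis
  proof (intro conjI impI)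
    show "\<forall>t>t\<^sub>0.
      (\<forall>\<epsilon>\<in>{0<..<1}. strong_bochner_integrable (lebesgue_on {0<..})
        (\<lambda>\<tau>. (\<tau> powr (\<epsilon> - 1) / (\<tau> + 1)) *\<^sub>R
          S ((t - t\<^sub>0) * (\<tau> + 1)) (g (t\<^sub>0 - (t - t\<^sub>0) * \<tau>)))) \<and>
      ((\<lambda>\<epsilon>. (sin (pi * \<epsilon>) / pi) *\<^sub>R strong_bochner_integral (lebesgue_on {0<..})
        (\<lambda>\<tau>. (\<tau> powr (\<epsilon> - 1) / (\<tau> + 1)) *\<^sub>R
          S ((t - t\<^sub>0) * (\<tau> + 1)) (g (t\<^sub>0 - (t - t\<^sub>0) * \<tau>))))
        \<longlongrightarrow> S (t - t\<^sub>0) (g t\<^sub>0)) (at 0 within {0<..<1})"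
      using singular_kernel_concentrates_at_0[OF h_cont' h_bound h_0]
      by (simp add: h_def)
  next
    assume "uniformly_exponentially_stable S"
    then obtain M v where M: "M \<ge> 1" and v: "v > 0" and exp: "exp_bounded S M v"
      unfolding uniformly_exponentially_stable_def by blast
    have h_decay: "norm (h c \<tau>) \<le> M * G * exp (- (v * c) * \<tau>)" if "c > 0" "\<tau> > 0" for c \<tau>
    proof -
      have "norm (h c \<tau>) \<le> M * exp (- v * (c * (\<tau> + 1))) * norm (g (t\<^sub>0 - c * \<tau>))"
        unfolding h_def using that by (intro exp_bounded_norm_le[OF assms(1) exp]) auto
      also have "\<dots> \<le> M * exp (- (v * c) * \<tau>) * G"
        using that M v by (intro mult_mono G) (auto simp: algebra_simps)
      finally show ?thesis by (simp add: mult_ac)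
    qed
    show "\<forall>t>t\<^sub>0.
      (\<forall>\<epsilon>\<in>{0<..<1}. strong_bochner_integrable (lebesgue_on {0<..})
        (\<lambda>\<tau>. (\<tau> powr (- \<epsilon>) / (\<tau> + 1)) *\<^sub>R
          S ((t - t\<^sub>0) * (\<tau> + 1)) (g (t\<^sub>0 - (t - t\<^sub>0) * \<tau>)))) \<and>
      ((\<lambda>\<epsilon>. (sin (pi * \<epsilon>) / pi) *\<^sub>R strong_bochner_integral (lebesgue_on {0<..})
        (\<lambda>\<tau>. (\<tau> powr (- \<epsilon>) / (\<tau> + 1)) *\<^sub>R
          S ((t - t\<^sub>0) * (\<tau> + 1)) (g (t\<^sub>0 - (t - t\<^sub>0) * \<tau>))))
        \<longlongrightarrow> 0) (at 0 within {0<..<1})"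
      using decaying_kernel_vanishes[OF h_cont' _ h_decay] v
      by (simp add: h_def)
  qed
qed

end
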